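(* Let $m_0$ be a complex polynomial in one variable $z$, let $N\in\{2,3,\dots\}$, and let $\rho=e^{2\pi i/N}$. Suppose $$|m_0(z)|^2+|m_0(z\rho)|^2+\dots+|m_0(z\rho^{N-1})|^2=N$$ for all $z\in\mathbb{T}=\{z\in\mathbb{C}:|z|=1\}$. Then there are polynomials $m_1,\dots,m_{N-1}$ such that the combined system $\{m_i:0\le i<N\}$ has the property that the $N\times N$ matrix $$M(z)=\frac{1}{\sqrt N}\bigl(m_i(\rho^k z)\bigr)_{i,k=0}^{N-1}$$ is unitary for all $z\in\mathbb{T}$ (equivalently, $\sum_{k=0}^{N-1}\overline{m_i(\rho^kz)}\,m_j(\rho^kz)=\delta_{i,j}N$ for all $z\in\mathbb{T}$ and $0\le i,j\le N-1$). Furthermore, when $g\in\mathbb{N}$ is chosen such that the degree of $m_0$ is at most $Ng-1$, the polynomials $m_1,\dots,m_{N-1}$ can be taken to have degree at most $Ng-1$. *)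

theory Defs
  imports
    "HOL-Analysis.Analysis"
    "HOL-Computational_Algebra.Polynomial"
    "Jordan_Normal_Form.Schur_Decomposition"
begin

definition root_rho :: "nat \<Rightarrow> complex" where
  "root_rho N = exp (2 * of_real pi * \<i> / of_nat N)"

definition unitary_matrix :: "complex mat \<Rightarrow> bool" where
  "unitary_matrix A \<longleftrightarrow> square_mat A \<and> inverts_mat A (mat_adjoint A) \<and> inverts_mat (mat_adjoint A) A"

(* Only the values m 0, ..., m (N - 1) of the family m are used. *)
definition filter_matrix :: "nat \<Rightarrow> (nat \<Rightarrow> complex poly) \<Rightarrow> complex \<Rightarrow> complex mat" where
  "filter_matrix N m z =
     mat N N (\<lambda>(i, k). complex_of_real (1 / sqrt (real N)) * poly (m i) (root_rho N ^ k * z))"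

end

theory Submission
  imports Defs
begin

text \<open>Splitting \<open>m(z) = \<Sum>l<N. z ^ l * A l (z ^ N)\<close> into its polyphase components turns the
  orthogonality relations into pointwise orthonormality, on the unit circle, of the vectors
  \<open>A = (A 0, \<dots>, A (N - 1))\<close>. So a polynomial vector \<open>v\<close> of degree at most \<open>d = g - 1\<close> and of norm 1 on
  the circle has to be completed to a unitary polynomial matrix of the same degree. If \<open>b\<close> is the
  coefficient of \<open>w ^ d\<close> in \<open>v\<close>, then \<open>b\<close> is orthogonal to the constant coefficient, and therefore
  \<open>v = (I + (w - 1) P) v'\<close> with \<open>P\<close> the projection onto the line of \<open>b\<close> and \<open>v'\<close> a polynomial vector
  of degree at most \<open>d - 1\<close> and norm 1. A completion of \<open>v'\<close> is mapped by the unitary factor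
  to one of \<open>v\<close>; for \<open>d = 0\<close> one completes a constant unit vector.\<close>

hide_const (open) Module.smult

section \<open>Hermitian inner product and completion of constant unit vectors\<close>

definition hdot :: "nat \<Rightarrow> (nat \<Rightarrow> complex) \<Rightarrow> (nat \<Rightarrow> complex) \<Rightarrow> complex" where
  "hdot N x y = (\<Sum>l<N. cnj (x l) * y l)"

lemma hdot_cong:
  "(\<And>l. l < N \<Longrightarrow> x l = x' l) \<Longrightarrow> (\<And>l. l < N \<Longrightarrow> y l = y' l) \<Longrightarrow> hdot N x y = hdot N x' y'"
  by (simp add: hdot_def)

lemma cnj_hdot: "cnj (hdot N x y) = hdot N y x"
  by (simp add: hdot_def mult.commute)

lemma hdot_self: "hdot N x x = of_real (\<Sum>l<N. (cmod (x l))\<^sup>2)"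
  by (simp add: hdot_def complex_norm_square mult.commute del: of_real_power)

lemma hdot_self_eq_0_iff: "hdot N x x = 0 \<longleftrightarrow> (\<forall>l<N. x l = 0)"
  unfolding hdot_self of_real_eq_0_iff by (subst sum_nonneg_eq_0_iff) auto

text \<open>Serves every rank-one update along a line, both \<open>I + (u - 1) P\<close> and the
  difference \<open>c - e 0\<close>.\<close>

lemma hdot_add_scaled:
  "hdot N (\<lambda>l. x l + b l * c) (\<lambda>l. y l + b l * d)
     = hdot N x y + hdot N x b * d + cnj c * hdot N b y + cnj c * d * hdot N b b"
  by (simp add: hdot_def algebra_simps sum.distrib sum_distrib_left)

lemma hdot_unit_vectors:
  "i < N \<Longrightarrow> hdot N (\<lambda>l. of_bool (l = i)) (\<lambda>l. of_bool (l = j)) = (if i = j then 1 else 0)"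
  by (simp add: hdot_def of_bool_def if_distrib[of "\<lambda>x. x * _"] if_distrib[of cnj] cong: if_cong)

text \<open>The map \<open>I + (u - 1) P\<close>, with \<open>P\<close> the orthogonal projection onto the line of \<open>b\<close>, is
  unitary; the degenerate case \<open>b = 0\<close> gives the identity because \<open>x / 0 = 0\<close>.\<close>
lemma hdot_rotate_line:
  assumes u: "cmod u = 1"
  shows "hdot N (\<lambda>l. x l + b l * ((u - 1) * hdot N b x / hdot N b b))
                (\<lambda>l. y l + b l * ((u - 1) * hdot N b y / hdot N b b)) = hdot N x y"
proof (cases "hdot N b b = 0")
  case False
  define s where "s = hdot N b b"
  have s: "s \<noteq> 0" "cnj s = s" using False by (auto simp: s_def cnj_hdot)
  have "cnj u * u = 1" using u complex_norm_square[of u] by (simp add: mult.commute)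
  \<comment> \<open>The left side is \<open>cnj u * u - 1\<close>, the factor common to all
    correction terms.\<close>
  then have e: "(u - 1) + (cnj u - 1) + (cnj u - 1) * (u - 1) = 0"
    by (simp add: algebra_simps)
  have "hdot N x b * ((u - 1) * hdot N b y / s)
      + cnj ((u - 1) * hdot N b x / s) * hdot N b y
      + cnj ((u - 1) * hdot N b x / s) * ((u - 1) * hdot N b y / s) * s
    = hdot N x b * hdot N b y / s * ((u - 1) + (cnj u - 1) + (cnj u - 1) * (u - 1))"
    using s by (simp add: cnj_hdot field_simps)
  then show ?thesis unfolding hdot_add_scaled s_def[symmetric] e by (simp add: add.assoc)
qed simp

text \<open>With \<open>b = c - e\<^sub>0\<close> the value of \<open>u\<close> below is the unimodular number for which
  \<open>I + (u - 1) P\<close> maps \<open>e\<^sub>0\<close> to \<open>c\<close>: a complex Householder reflection.\<close>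
lemma unit_vector_completion:
  assumes N: "0 < N" and c: "hdot N c c = 1"
  shows "\<exists>V. (\<forall>l<N. V 0 l = c l) \<and>
             (\<forall>i<N. \<forall>j<N. hdot N (V i) (V j) = (if i = j then 1 else 0))"
proof -
  define e :: "nat \<Rightarrow> nat \<Rightarrow> complex" where "e i l = of_bool (l = i)" for i l
  define b where "b l = c l + e 0 l * (-1)" for l
  define u where "u = - (1 - c 0) / cnj (1 - c 0)"
  \<comment> \<open>For \<open>c 0 = 1\<close> the quotient \<open>u\<close> is
    \<open>0 / 0 = 0\<close>, which is not unimodular. In that case \<open>b\<close> vanishes below
    \<open>N\<close>, and \<open>u' = 1\<close> gives the identity map.\<close>
  define u' where "u' = (if c 0 = 1 then 1 else u)"
  define V where "V i l = e i l + b l * ((u' - 1) * hdot N b (e i) / hdot N b b)" for i l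
  have e0: "hdot N (e 0) y = y 0" for y
    using N by (simp add: hdot_def e_def of_bool_def if_distrib[of "\<lambda>x. x * _"] if_distrib[of cnj] cong: if_cong)
  have be: "hdot N b (e 0) = cnj (c 0) - 1"
    using e0[of b, THEN arg_cong[of _ _ cnj]] by (simp add: cnj_hdot b_def e_def)
  have bb: "hdot N b b = 2 - c 0 - cnj (c 0)"
  proof -
    have "hdot N c (e 0) = cnj (c 0)" using e0[of c, THEN arg_cong[of _ _ cnj]] by (simp add: cnj_hdot)
    then show ?thesis
      unfolding b_def hdot_add_scaled by (simp add: e0 c) (simp add: e_def)
  qed
  have u': "cmod u' = 1"
    by (simp add: u'_def u_def norm_divide norm_minus_commute del: complex_cnj_diff)
  have "V 0 l = c l" if "l < N" for l
  proof (cases "c 0 = 1")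
    case True
    then have "b l = 0" using bb that hdot_self_eq_0_iff[of N b] by simp
    then show ?thesis by (simp add: V_def b_def)
  next
    case False
    have nz: "hdot N b b \<noteq> 0"
    proof
      assume "hdot N b b = 0"
      then have "b 0 = 0" using N hdot_self_eq_0_iff[of N b] by simp
      with False show False by (simp add: b_def e_def)
    qed
    have "cnj (c 0) - 1 \<noteq> 0" using False by (metis complex_cnj_cnj complex_cnj_one eq_iff_diff_eq_0)
    \<comment> \<open>So the coefficient of \<open>b\<close> in \<open>V 0\<close> is 1, and
      \<open>V 0\<close> becomes \<open>e 0 + b = c\<close>.\<close>
    then have "(u' - 1) * (cnj (c 0) - 1) = hdot N b b"
      using False by (simp add: u'_def u_def bb field_simps)
    then show ?thesis using nz by (simp add: V_def be b_def)
  qed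
  moreover have "hdot N (V i) (V j) = (if i = j then 1 else 0)" if "i < N" "j < N" for i j
    unfolding V_def hdot_rotate_line[OF u'] unfolding e_def using that by (simp add: hdot_unit_vectors)
  ultimately show ?thesis by blast
qed

section \<open>Polynomial vectors of norm 1 on the circle\<close>

text \<open>A finite connected set has at most one point. Infinitely many points are what turns an
  identity on the circle into one of polynomials.\<close>

lemma infinite_unit_circle: "infinite {w::complex. cmod w = 1}"
proof -
  have "infinite (sphere (0::complex) 1)"
  proof -
    have "(1::complex) \<in> sphere 0 1" "(-1::complex) \<in> sphere 0 1" by auto
    then have "\<nexists>a. sphere (0::complex) 1 = {a}" by (metis one_neq_neg_one singletonD)
    then show ?thesis by (simp add: connected_sphere connected_finite_iff_sing)
  qed
  then show ?thesis by (simp add: sphere_def)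
qed

lemma poly_altdef_lessThan:
  fixes p :: "'a::comm_semiring_1 poly"
  assumes "degree p < n"
  shows "poly p x = (\<Sum>i<n. coeff p i * x ^ i)"
  unfolding poly_altdef using assms
  by (intro sum.mono_neutral_left) (auto simp: coeff_eq_0)

text \<open>On the circle \<open>cnj w = 1 / w\<close>, so the constant norm is a polynomial identity after
  multiplication by \<open>w ^ d\<close>; its constant term is the claim.\<close>
lemma unit_polynomial_vector_extreme_coeffs:
  fixes v :: "nat \<Rightarrow> complex poly"
  assumes d: "0 < d" and deg: "\<And>l. l < N \<Longrightarrow> degree (v l) \<le> d"
    and unit: "\<And>w. cmod w = 1 \<Longrightarrow> hdot N (\<lambda>l. poly (v l) w) (\<lambda>l. poly (v l) w) = 1"
  shows "hdot N (\<lambda>l. coeff (v l) d) (\<lambda>l. coeff (v l) 0) = 0"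
proof -
  \<comment> \<open>The reciprocal polynomial with conjugated coefficients: a polynomial substitute
    on the circle for the conjugate of \<open>v l\<close>, up to the factor
    \<open>w ^ d\<close>.\<close>
  define R where "R l = (\<Sum>k\<le>d. monom (cnj (coeff (v l) k)) (d - k))" for l
  define F where "F = (\<Sum>l<N. R l * v l) - monom 1 d"
  have R: "poly (R l) w = w ^ d * cnj (poly (v l) w)" if w: "cmod w = 1" and l: "l < N" for l w
  proof -
    have *: "w ^ (d - k) = w ^ d * cnj w ^ k" if "k \<le> d" for k
    proof -
      have "w * cnj w = 1" using w complex_norm_square[of w] by simp
      then have "w ^ k * cnj w ^ k = 1" by (simp flip: power_mult_distrib)
      moreover have "w ^ d = w ^ (d - k) * w ^ k" using that by (simp flip: power_add)
      ultimately show ?thesis by (simp add: mult.assoc)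
    qed
    have "poly (v l) w = (\<Sum>k\<le>d. coeff (v l) k * w ^ k)"
      using poly_altdef_lessThan[of "v l" "Suc d" w] deg[OF l] by (simp add: lessThan_Suc_atMost)
    then show ?thesis
      by (simp add: R_def poly_sum poly_monom * sum_distrib_left mult_ac)
  qed
  have "poly F w = 0" if w: "cmod w = 1" for w
  proof -
    have "poly F w = w ^ d * hdot N (\<lambda>l. poly (v l) w) (\<lambda>l. poly (v l) w) - w ^ d"
      by (simp add: F_def poly_sum poly_monom hdot_def R[OF w] sum_distrib_left mult.assoc)
    then show ?thesis by (simp add: unit[OF w])
  qed
  then have "infinite {w. poly F w = 0}"
    using infinite_unit_circle by (metis (mono_tags, lifting) infinite_super mem_Collect_eq subsetI)
  then have "F = 0" using poly_roots_finite by blast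
  then have "0 = coeff F 0" by simp
  \<comment> \<open>Since \<open>0 < d\<close>, the term \<open>monom 1 d\<close> has no constant
    coefficient.\<close>
  also have "coeff F 0 = (\<Sum>l<N. coeff (R l) 0 * coeff (v l) 0)"
    using d by (simp add: F_def coeff_sum coeff_mult_0 coeff_mult)
  also have "\<dots> = hdot N (\<lambda>l. coeff (v l) d) (\<lambda>l. coeff (v l) 0)"
  proof -
    have "coeff (R l) 0 = (\<Sum>k\<in>{d}. cnj (coeff (v l) k))" for l
      unfolding R_def coeff_sum by (rule sum.mono_neutral_cong_right) auto
    then show ?thesis by (simp add: hdot_def)
  qed
  finally show ?thesis by simp
qed

text \<open>Each induction step splits one factor \<open>I + (w - 1) P\<close> off \<open>v\<close>
  and applies it to all vectors of the smaller completion; this preserves inner products on the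
  circle and raises degrees by at most one.\<close>

theorem unit_polynomial_vector_completion:
  fixes v :: "nat \<Rightarrow> complex poly"
  assumes N: "0 < N" and "\<And>l. l < N \<Longrightarrow> degree (v l) \<le> d"
    and "\<And>w. cmod w = 1 \<Longrightarrow> hdot N (\<lambda>l. poly (v l) w) (\<lambda>l. poly (v l) w) = 1"
  shows "\<exists>V. (\<forall>l<N. V 0 l = v l) \<and> (\<forall>i<N. \<forall>l<N. degree (V i l) \<le> d) \<and>
             (\<forall>w. cmod w = 1 \<longrightarrow> (\<forall>i<N. \<forall>j<N.
                hdot N (\<lambda>l. poly (V i l) w) (\<lambda>l. poly (V j l) w) = (if i = j then 1 else 0)))"
  using assms(2-)
proof (induction d arbitrary: v)
  case 0
  define c where "c l = coeff (v l) 0" for l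
  have v: "v l = [:c l:]" if "l < N" for l
    using "0.prems"(1)[OF that] by (auto simp: c_def elim: degree_eq_zeroE)
  have "hdot N c c = hdot N (\<lambda>l. poly (v l) 1) (\<lambda>l. poly (v l) 1)"
    by (rule hdot_cong) (simp_all add: v)
  then have "hdot N c c = 1" using "0.prems"(2)[of 1] by simp
  from unit_vector_completion[OF N this] obtain W where
    W: "\<forall>l<N. W 0 l = c l" "\<forall>i<N. \<forall>j<N. hdot N (W i) (W j) = (if i = j then 1 else 0)" by blast
  show ?case
    by (rule exI[of _ "\<lambda>i l. [:W i l:]"]) (use W v in simp)
next
  case (Suc d)
  define b where "b l = coeff (v l) (Suc d)" for l
  define s where "s = hdot N b b"
  show ?case
  proof (cases "s = 0")
    case True
    then have b0: "b l = 0" if "l < N" for l using that hdot_self_eq_0_iff[of N b] by (simp add: s_def)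
    have "degree (v l) \<le> d" if "l < N" for l
    proof (rule ccontr)
      assume "\<not> degree (v l) \<le> d"
      then have eq: "degree (v l) = Suc d" using Suc.prems(1)[OF that] by simp
      then have "lead_coeff (v l) = 0" using b0[OF that] by (simp add: b_def)
      then have "v l = 0" by (simp only: leading_coeff_0_iff)
      with eq show False by simp
    qed
    from Suc.IH[OF this Suc.prems(2)] obtain V where V: "\<forall>l<N. V 0 l = v l"
      "\<forall>i<N. \<forall>l<N. degree (V i l) \<le> d"
      "\<forall>w. cmod w = 1 \<longrightarrow> (\<forall>i<N. \<forall>j<N.
         hdot N (\<lambda>l. poly (V i l) w) (\<lambda>l. poly (V j l) w) = (if i = j then 1 else 0))"
      by blast
    show ?thesis by (rule exI[of _ V]) (use V in \<open>auto intro: le_SucI\<close>)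
  next
    case False
    \<comment> \<open>The coordinate of the projection: \<open>P x\<close> is \<open>b\<close> times
      the scalar polynomial \<open>proj x\<close>.\<close>
    define proj where "proj x = smult (1 / s) (\<Sum>l<N. smult (cnj (b l)) (x l))"
      for x :: "nat \<Rightarrow> complex poly"
    have poly_proj: "poly (proj x) w = hdot N b (\<lambda>l. poly (x l) w) / s" for x w
      by (simp add: proj_def poly_sum hdot_def)
    have coeff_proj: "coeff (proj x) k = hdot N b (\<lambda>l. coeff (x l) k) / s" for x k
      by (simp add: proj_def coeff_sum hdot_def)
    define p where "p = proj v"
    \<comment> \<open>The extreme coefficients are orthogonal, so \<open>w\<close> divides the
      coordinate of \<open>v\<close> along \<open>b\<close>.\<close>
    have "coeff p 0 = 0"
      unfolding p_def coeff_proj b_def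
      using unit_polynomial_vector_extreme_coeffs[OF _ Suc.prems] by simp
    then have "[:0, 1:] dvd p" using poly_eq_0_iff_dvd[of p 0] by (simp add: poly_0_coeff_0)
    then obtain q where q: "p = [:0, 1:] * q" by (elim dvdE)
    have coeff_q: "coeff q k = coeff p (Suc k)" for k by (simp add: q)
    \<comment> \<open>The inverse factor is \<open>I + (1 / w - 1) P\<close>; as
      \<open>p = w * q\<close>, it sends \<open>v\<close> to the polynomial vector
      \<open>v - (w - 1) * q * b\<close>.\<close>
    define v' where "v' l = v l - smult (b l) ([:-1, 1:] * q)" for l
    have proj_v': "proj v' = q"
    proof -
      have "poly (proj v') w = poly q w" for w
      proof -
        have "poly (v' l) w = poly (v l) w - b l * ((w - 1) * poly q w)" for l
          by (simp add: v'_def algebra_simps)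
        then have "hdot N b (\<lambda>l. poly (v' l) w) = hdot N b (\<lambda>l. poly (v l) w) - s * ((w - 1) * poly q w)"
          by (simp only: hdot_def s_def right_diff_distrib sum_subtractf sum_distrib_right mult.assoc)
        moreover have "hdot N b (\<lambda>l. poly (v l) w) = s * (w * poly q w)"
          using poly_proj[of v w] False unfolding p_def[symmetric] q by (simp add: field_simps)
        ultimately have "hdot N b (\<lambda>l. poly (v' l) w) = s * poly q w"
          by (simp add: algebra_simps)
        then show ?thesis using False by (simp add: poly_proj)
      qed
      then show ?thesis by (simp add: poly_eq_poly_eq_iff[symmetric] fun_eq_iff)
    qed
    have v: "v l = v' l + smult (b l) ([:-1, 1:] * proj v')" for l
      by (simp add: proj_v' v'_def)
    have isometry: "hdot N (\<lambda>l. poly (x l + smult (b l) ([:-1, 1:] * proj x)) w)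
        (\<lambda>l. poly (y l + smult (b l) ([:-1, 1:] * proj y)) w)
        = hdot N (\<lambda>l. poly (x l) w) (\<lambda>l. poly (y l) w)" if "cmod w = 1" for x y w
    proof -
      have "poly (x l + smult (b l) ([:-1, 1:] * proj x)) w
          = poly (x l) w + b l * ((w - 1) * hdot N b (\<lambda>l. poly (x l) w) / s)" for x l
        by (simp add: poly_proj algebra_simps diff_divide_distrib)
      then show ?thesis using hdot_rotate_line[OF that, of N "\<lambda>l. poly (x l) w" b "\<lambda>l. poly (y l) w"]
        by (simp only: s_def[symmetric])
    qed
    have deg': "degree (v' l) \<le> d" if l: "l < N" for l
    proof (rule degree_le, intro allI impI)
      fix k assume k: "d < k"
      have cq: "coeff ([:-1, 1:] * q) k = coeff p k - coeff p (Suc k)"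
        using k by (simp add: coeff_q coeff_pCons split: nat.split)
      have high: "coeff (v l) k = 0" if "Suc d < k" "l < N" for l k
        using Suc.prems(1)[OF that(2)] that(1) by (simp add: coeff_eq_0)
      have highp: "coeff p k = 0" if "Suc d < k" for k
        using high[OF that] by (simp add: p_def coeff_proj hdot_def)
      show "coeff (v' l) k = 0"
      proof (cases "k = Suc d")
        case True
        \<comment> \<open>The top coefficient vector of \<open>v\<close> is \<open>b\<close>, with
          coordinate \<open>hdot N b b / s\<close>; so the terms of degree \<open>Suc d\<close>
          cancel in \<open>v'\<close>.\<close>
        have "coeff p (Suc d) = 1"
          using False by (simp add: p_def coeff_proj b_def[symmetric] s_def[symmetric])
        then show ?thesis using True cq highp by (simp add: v'_def b_def)
      next
        case False
        then show ?thesis using k cq high[OF _ l] highp by (simp add: v'_def)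
      qed
    qed
    have "hdot N (\<lambda>l. poly (v' l) w) (\<lambda>l. poly (v' l) w) = 1" if "cmod w = 1" for w
      using isometry[OF that, of v' v'] Suc.prems(2)[OF that] unfolding v[symmetric] by simp
    from Suc.IH[OF deg' this] obtain V where V: "\<forall>l<N. V 0 l = v' l"
      "\<forall>i<N. \<forall>l<N. degree (V i l) \<le> d"
      "\<forall>w. cmod w = 1 \<longrightarrow> (\<forall>i<N. \<forall>j<N.
         hdot N (\<lambda>l. poly (V i l) w) (\<lambda>l. poly (V j l) w) = (if i = j then 1 else 0))"
      by blast
    show ?thesis
    proof (rule exI[of _ "\<lambda>i l. V i l + smult (b l) ([:-1, 1:] * proj (V i))"], intro conjI allI impI)
      fix l assume l: "l < N"
      \<comment> \<open>\<open>V 0\<close> and \<open>v'\<close> are known to agree only below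
        \<open>N\<close>, which is all that \<open>proj\<close> reads.\<close>
      have "proj (V 0) = proj v'" using V(1) by (simp add: proj_def)
      then show "V 0 l + smult (b l) ([:-1, 1:] * proj (V 0)) = v l" using V(1) l v[of l] by simp
    next
      fix i l assume il: "i < N" "l < N"
      have "degree (proj (V i)) \<le> d" unfolding proj_def using V(2) il
        by (intro order.trans[OF degree_smult_le] degree_sum_le) auto
      then have "degree ([:-1, 1:] * proj (V i)) \<le> Suc d"
        by (intro order.trans[OF degree_mult_le]) simp
      then show "degree (V i l + smult (b l) ([:-1, 1:] * proj (V i))) \<le> Suc d"
        using V(2) il by (intro degree_add_le order.trans[OF degree_smult_le]) (auto intro: le_SucI)
    next
      fix w :: complex and i j assume w: "cmod w = 1" and "i < N" "j < N"
      then show "hdot N (\<lambda>l. poly (V i l + smult (b l) ([:-1, 1:] * proj (V i))) w)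
          (\<lambda>l. poly (V j l + smult (b l) ([:-1, 1:] * proj (V j))) w) = (if i = j then 1 else 0)"
        unfolding isometry[OF w] using V(3) by blast
    qed
  qed
qed

section \<open>Orthogonality of roots of unity\<close>

lemma root_rho_power: "root_rho N ^ j = exp (2 * of_real pi * \<i> * of_nat j / of_nat N)"
  by (simp add: root_rho_def mult_ac flip: exp_of_nat_mult)

lemma root_rho_power_self: "0 < N \<Longrightarrow> root_rho N ^ N = 1"
  by (simp add: root_rho_power)

lemma norm_root_rho: "cmod (root_rho N) = 1"
  by (simp add: root_rho_def norm_exp_eq_Re)

text \<open>A geometric sum whose ratio \<open>x\<close> is an \<open>N\<close>-th root of unity;
  \<open>x\<close> is 1 only for \<open>l = l'\<close>, because both exponents lie below
  \<open>N\<close>.\<close>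

lemma root_rho_orthogonality:
  assumes "l < N" "l' < N"
  shows "(\<Sum>k<N. cnj ((root_rho N ^ k) ^ l) * (root_rho N ^ k) ^ l') = (if l = l' then of_nat N else 0)"
proof -
  define r where "r = root_rho N"
  define x where "x = cnj (r ^ l) * r ^ l'"
  have N: "0 < N" using assms by simp
  have rc: "cnj r * r = 1" using norm_root_rho[of N] complex_norm_square[of r] by (simp add: r_def mult.commute)
  have "(\<Sum>k<N. cnj ((r ^ k) ^ l) * (r ^ k) ^ l') = (\<Sum>k<N. x ^ k)"
    by (simp add: x_def power_mult_distrib mult.commute flip: power_mult)
  moreover have "x ^ N = 1"
  proof -
    have "x ^ N = cnj ((r ^ N) ^ l) * (r ^ N) ^ l'"
      by (simp add: x_def power_mult_distrib mult.commute flip: power_mult)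
    then show ?thesis by (simp add: r_def root_rho_power_self[OF N])
  qed
  moreover have "x = 1 \<longleftrightarrow> l = l'"
  proof
    assume "x = 1"
    have "r ^ l * x = (cnj r * r) ^ l * r ^ l'" by (simp add: x_def power_mult_distrib)
    then have "r ^ l' = r ^ l" using \<open>x = 1\<close> rc by simp
    then show "l = l'"
      unfolding r_def root_rho_power using complex_root_unity_eq[of N l' l] N assms by simp
  next
    assume "l = l'"
    then have "x = (cnj r * r) ^ l" by (simp add: x_def power_mult_distrib)
    then show "x = 1" using rc by simp
  qed
  ultimately show ?thesis using sum_gp_strict[of x N] by (simp add: r_def)
qed

section \<open>Polyphase decomposition\<close>

text \<open>For \<open>l < N\<close> this picks the coefficients at indices congruent to
  \<open>l\<close> modulo \<open>N\<close>. The cut at \<open>g\<close> builds in the degree bound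
  and loses nothing when \<open>degree p < N * g\<close>.\<close>

definition polyphase_component :: "nat \<Rightarrow> nat \<Rightarrow> complex poly \<Rightarrow> nat \<Rightarrow> complex poly" where
  "polyphase_component N g p l = (\<Sum>k<g. monom (coeff p (k * N + l)) k)"

definition polyphase_synthesis :: "nat \<Rightarrow> (nat \<Rightarrow> complex poly) \<Rightarrow> complex poly" where
  "polyphase_synthesis N A = (\<Sum>l<N. monom 1 l * pcompose (A l) (monom 1 N))"

lemma poly_polyphase_synthesis:
  "poly (polyphase_synthesis N A) z = (\<Sum>l<N. z ^ l * poly (A l) (z ^ N))"
  by (simp add: polyphase_synthesis_def poly_sum poly_monom poly_pcompose)

lemma degree_polyphase_component: "degree (polyphase_component N g p l) \<le> g - 1"
  unfolding polyphase_component_def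
  by (intro degree_sum_le order.trans[OF degree_monom_le]) auto

text \<open>The exponents below \<open>g * N\<close> are cut into \<open>g\<close> blocks of length
  \<open>N\<close>; exchanging the two sums regroups them by residue.\<close>

lemma polyphase_synthesis_component:
  assumes "degree p < N * g"
  shows "polyphase_synthesis N (polyphase_component N g p) = p"
proof -
  have "poly (polyphase_synthesis N (polyphase_component N g p)) z = poly p z" for z
  proof -
    have "poly p z = (\<Sum>i<g * N. coeff p i * z ^ i)"
      using assms by (intro poly_altdef_lessThan) (simp add: mult.commute)
    also have "\<dots> = (\<Sum>k<g. \<Sum>i\<in>{k * N..<k * N + N}. coeff p i * z ^ i)"
      by (simp add: sum.nat_group)
    also have "\<dots> = (\<Sum>k<g. \<Sum>l<N. coeff p (k * N + l) * z ^ (k * N + l))"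
      by (simp add: sum.atLeastLessThan_shift_0[of _ "_ * N"] lessThan_atLeast0 add.commute)
    also have "\<dots> = (\<Sum>l<N. \<Sum>k<g. coeff p (k * N + l) * z ^ (k * N + l))"
      by (rule sum.swap)
    also have "\<dots> = poly (polyphase_synthesis N (polyphase_component N g p)) z"
      unfolding poly_polyphase_synthesis polyphase_component_def
      by (simp add: poly_sum poly_monom sum_distrib_left power_add mult_ac flip: power_mult)
    finally show ?thesis by simp
  qed
  then show ?thesis by (simp add: poly_eq_poly_eq_iff[symmetric] fun_eq_iff)
qed

lemma degree_polyphase_synthesis:
  assumes "0 < g" and "\<And>l. l < N \<Longrightarrow> degree (A l) \<le> g - 1"
  shows "degree (polyphase_synthesis N A) \<le> N * g - 1"
  unfolding polyphase_synthesis_def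
proof (rule degree_sum_le)
  fix l assume "l \<in> {..<N}"
  then have l: "l < N" by simp
  have "degree (monom 1 l * pcompose (A l) (monom 1 N)) \<le> l + degree (A l) * N"
    by (rule order.trans[OF degree_mult_le]) (simp add: degree_monom_eq)
  also have "\<dots> \<le> l + (g - 1) * N" using assms(2)[OF l] by simp
  \<comment> \<open>As \<open>l\<close> is at most \<open>N - 1\<close>, the sum is at most
    \<open>N - 1 + (g - 1) * N = N * g - 1\<close>.\<close>
  also have "\<dots> \<le> N * g - 1" using l \<open>0 < g\<close> by (cases g) (simp_all add: mult.commute)
  finally show "degree (monom 1 l * pcompose (A l) (monom 1 N)) \<le> N * g - 1" .
qed simp

text \<open>All points \<open>root_rho N ^ k * z\<close> have the same \<open>N\<close>-th power, so
  the components are evaluated at one point, and summing over \<open>k\<close> kills the cross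
  terms.\<close>

lemma polyphase_Parseval:
  assumes N: "0 < N" and z: "cmod z = 1"
  shows "(\<Sum>k<N. cnj (poly (polyphase_synthesis N A) (root_rho N ^ k * z))
              * poly (polyphase_synthesis N B) (root_rho N ^ k * z))
       = of_nat N * hdot N (\<lambda>l. poly (A l) (z ^ N)) (\<lambda>l. poly (B l) (z ^ N))"
proof -
  define r where "r = root_rho N"
  define a where "a l = poly (A l) (z ^ N)" for l
  define b where "b l = poly (B l) (z ^ N)" for l
  have rN: "(r ^ k * z) ^ N = z ^ N" for k
  proof -
    have "(r ^ k * z) ^ N = (r ^ N) ^ k * z ^ N"
      by (simp add: power_mult_distrib mult.commute flip: power_mult)
    then show ?thesis by (simp add: r_def root_rho_power_self[OF N])
  qed
  have zz: "cnj (z ^ l) * z ^ l = 1" for l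
  proof -
    have "cnj z * z = 1" using z complex_norm_square[of z] by (simp add: mult.commute)
    then show ?thesis by (metis complex_cnj_power power_mult_distrib power_one)
  qed
  have "(\<Sum>k<N. cnj (poly (polyphase_synthesis N A) (r ^ k * z)) * poly (polyphase_synthesis N B) (r ^ k * z))
      = (\<Sum>k<N. \<Sum>l<N. \<Sum>l'<N. cnj ((r ^ k * z) ^ l * a l) * ((r ^ k * z) ^ l' * b l'))"
    by (simp only: poly_polyphase_synthesis rN a_def[symmetric] b_def[symmetric] cnj_sum sum_product)
  also have "\<dots> = (\<Sum>l<N. \<Sum>l'<N. \<Sum>k<N. cnj ((r ^ k * z) ^ l * a l) * ((r ^ k * z) ^ l' * b l'))"
    by (subst sum.swap, rule sum.cong[OF refl], rule sum.swap)
  also have "\<dots> = (\<Sum>l<N. \<Sum>l'<N. cnj (z ^ l) * z ^ l' * (cnj (a l) * b l') *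
                      (\<Sum>k<N. cnj ((r ^ k) ^ l) * (r ^ k) ^ l'))"
    by (simp add: sum_distrib_left power_mult_distrib mult_ac)
  also have "\<dots> = (\<Sum>l<N. \<Sum>l'<N. if l = l' then cnj (a l) * b l' * of_nat N else 0)"
  proof (intro sum.cong refl)
    fix l l' assume "l \<in> {..<N}" "l' \<in> {..<N}"
    then have "(\<Sum>k<N. cnj ((r ^ k) ^ l) * (r ^ k) ^ l') = (if l = l' then of_nat N else 0)"
      unfolding r_def by (intro root_rho_orthogonality) auto
    then show "cnj (z ^ l) * z ^ l' * (cnj (a l) * b l') * (\<Sum>k<N. cnj ((r ^ k) ^ l) * (r ^ k) ^ l')
        = (if l = l' then cnj (a l) * b l' * of_nat N else 0)"
      using zz[of l] by (cases "l = l'") (simp_all only: if_True if_False, simp_all)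
  qed
  also have "\<dots> = of_nat N * hdot N a b"
    by (simp add: hdot_def sum_distrib_left mult_ac)
  finally show ?thesis by (simp add: r_def a_def[abs_def] b_def[abs_def])
qed

section \<open>Unitary filter matrices\<close>

text \<open>Parseval controls the components only at points \<open>z ^ N\<close>; these fill the
  circle.\<close>

lemma unit_circle_root:
  assumes "0 < N" "cmod w = 1"
  obtains z where "cmod z = 1" "z ^ N = w"
proof (rule that)
  have "w \<noteq> 0" using assms by auto
  then have "cis (Arg w) = w" using cis_Arg[of w] assms by (simp add: sgn_eq)
  moreover have "cis (Arg w / real N) ^ N = cis (Arg w)"
    using assms Complex.DeMoivre[of "Arg w / real N" N] by simp
  ultimately show "cis (Arg w / real N) ^ N = w" by simp
qed simp

text \<open>Up to the factor \<open>N\<close> and a swap of \<open>i\<close> and \<open>j\<close>,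
  the sums are the entries of \<open>F * mat_adjoint F\<close>; for square matrices a one-sided
  inverse is two-sided.\<close>

lemma unitary_filter_matrix_iff:
  assumes N: "0 < N"
  shows "unitary_matrix (filter_matrix N m z) \<longleftrightarrow> (\<forall>i<N. \<forall>j<N.
     (\<Sum>k<N. cnj (poly (m i) (root_rho N ^ k * z)) * poly (m j) (root_rho N ^ k * z))
       = (if i = j then of_nat N else 0))"
proof -
  define F where "F = filter_matrix N m z"
  define S where "S i j = (\<Sum>k<N. cnj (poly (m i) (root_rho N ^ k * z)) * poly (m j) (root_rho N ^ k * z))" for i j
  have dim: "F \<in> carrier_mat N N" "mat_adjoint F \<in> carrier_mat N N"
    by (auto simp: F_def filter_matrix_def mat_adjoint_def)
  have sq: "complex_of_real (1 / sqrt N) * complex_of_real (1 / sqrt N) = 1 / of_nat N"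
    by (simp flip: of_real_mult)
  have entry: "(F * mat_adjoint F) $$ (i, j) = S j i / of_nat N" if "i < N" "j < N" for i j
  proof -
    have "(F * mat_adjoint F) $$ (i, j) = (\<Sum>k<N. F $$ (i, k) * mat_adjoint F $$ (k, j))"
      using dim that by (simp add: scalar_prod_def lessThan_atLeast0)
    also have "\<dots> = (\<Sum>k<N. F $$ (i, k) * cnj (F $$ (j, k)))"
      using dim that by (simp add: mat_adjoint_def mat_of_rows_def)
    also have "\<dots> = (\<Sum>k<N. (complex_of_real (1 / sqrt N) * complex_of_real (1 / sqrt N)) *
        (cnj (poly (m j) (root_rho N ^ k * z)) * poly (m i) (root_rho N ^ k * z)))"
      using that by (simp add: F_def filter_matrix_def mult_ac)
    finally show ?thesis by (simp only: sq S_def flip: sum_distrib_left) simp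
  qed
  have "unitary_matrix F \<longleftrightarrow> F * mat_adjoint F = 1\<^sub>m N"
    using dim mat_mult_left_right_inverse[OF dim] by (auto simp: unitary_matrix_def inverts_mat_def)
  also have "\<dots> \<longleftrightarrow> (\<forall>i<N. \<forall>j<N. S j i / of_nat N = (if i = j then 1 else 0))"
    using dim entry by (auto simp: mat_eq_iff)
  also have "\<dots> \<longleftrightarrow> (\<forall>i<N. \<forall>j<N. S i j = (if i = j then of_nat N else 0))"
    using N by (auto simp: field_simps split: if_splits)
  finally show ?thesis by (simp add: F_def S_def)
qed

theorem unitary_filter_bank_completion:
  assumes N: "0 < N" and g: "0 < g" and deg: "degree p \<le> N * g - 1"
    and unit: "\<And>z. cmod z = 1 \<Longrightarrow> (\<Sum>k<N. (cmod (poly p (z * root_rho N ^ k)))\<^sup>2) = real N"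
  shows "\<exists>m. m 0 = p \<and> (\<forall>i\<in>{1..<N}. degree (m i) \<le> N * g - 1) \<and>
             (\<forall>z\<in>sphere 0 1. unitary_matrix (filter_matrix N m z))"
proof -
  define A where "A = polyphase_component N g p"
  \<comment> \<open>\<open>N * g\<close> is positive, so the subtraction in \<open>deg\<close> is
    not truncated.\<close>
  have "degree p < N * g" using deg N g by (simp add: le_less_trans)
  then have syn: "polyphase_synthesis N A = p" unfolding A_def by (rule polyphase_synthesis_component)
  have unitA: "hdot N (\<lambda>l. poly (A l) w) (\<lambda>l. poly (A l) w) = 1" if w: "cmod w = 1" for w
  proof -
    obtain z where z: "cmod z = 1" "z ^ N = w" using unit_circle_root[OF N w] by metis
    have "of_nat N * hdot N (\<lambda>l. poly (A l) w) (\<lambda>l. poly (A l) w)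
        = (\<Sum>k<N. cnj (poly p (root_rho N ^ k * z)) * poly p (root_rho N ^ k * z))"
      using polyphase_Parseval[OF N z(1), of A A] by (simp add: syn z)
    also have "\<dots> = of_real (\<Sum>k<N. (cmod (poly p (z * root_rho N ^ k)))\<^sup>2)"
      by (simp only: of_real_sum complex_norm_square mult.commute)
    finally show ?thesis using unit[OF z(1)] N by simp
  qed
  have "degree (A l) \<le> g - 1" for l unfolding A_def by (rule degree_polyphase_component)
  from unit_polynomial_vector_completion[OF N this unitA] obtain V where V: "\<forall>l<N. V 0 l = A l"
    "\<forall>i<N. \<forall>l<N. degree (V i l) \<le> g - 1"
    "\<forall>w. cmod w = 1 \<longrightarrow> (\<forall>i<N. \<forall>j<N.
       hdot N (\<lambda>l. poly (V i l) w) (\<lambda>l. poly (V j l) w) = (if i = j then 1 else 0))"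
    by blast
  define m where "m i = polyphase_synthesis N (V i)" for i
  have "m 0 = p" using V(1) by (simp add: m_def polyphase_synthesis_def flip: syn)
  moreover have "\<forall>i\<in>{1..<N}. degree (m i) \<le> N * g - 1"
    unfolding m_def using V(2) by (intro ballI degree_polyphase_synthesis g) simp
  moreover have "\<forall>z\<in>sphere 0 1. unitary_matrix (filter_matrix N m z)"
    using V(3) N by (auto simp: unitary_filter_matrix_iff m_def polyphase_Parseval norm_power)
  ultimately show ?thesis by blast
qed

theorem corollary4p2:
  fixes m0 :: "complex poly" and N :: nat
  assumes "N \<ge> 2"
    and "\<forall>z\<in>sphere (0::complex) 1.
           (\<Sum>k<N. (cmod (poly m0 (z * root_rho N ^ k)))\<^sup>2) = real N"
  shows "(\<exists>m :: nat \<Rightarrow> complex poly. m 0 = m0 \<and>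
            (\<forall>z\<in>sphere 0 1. unitary_matrix (filter_matrix N m z)))
       \<and> (\<forall>m :: nat \<Rightarrow> complex poly.
            (\<forall>z\<in>sphere 0 1. unitary_matrix (filter_matrix N m z)) \<longleftrightarrow>
            (\<forall>z\<in>sphere 0 1. \<forall>i<N. \<forall>j<N.
               (\<Sum>k<N. cnj (poly (m i) (root_rho N ^ k * z)) * poly (m j) (root_rho N ^ k * z))
                 = (if i = j then of_nat N else 0)))
       \<and> (\<forall>g::nat. g \<ge> 1 \<and> degree m0 \<le> N * g - 1 \<longrightarrow>
            (\<exists>m :: nat \<Rightarrow> complex poly. m 0 = m0 \<and>
               (\<forall>i\<in>{1..<N}. degree (m i) \<le> N * g - 1) \<and>
               (\<forall>z\<in>sphere 0 1. unitary_matrix (filter_matrix N m z))))"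
proof -
  have N: "0 < N" using assms(1) by simp
  have unit: "(\<Sum>k<N. (cmod (poly m0 (z * root_rho N ^ k)))\<^sup>2) = real N" if "cmod z = 1" for z
    using assms(2) that by simp
  \<comment> \<open>The choice \<open>g = degree m0 + 1\<close> is always admissible and yields the
    existence claim without a degree bound.\<close>
  have degree_bound: "degree m0 \<le> N * (degree m0 + 1) - 1"
    using N by (cases N) simp_all
  show ?thesis
    using unitary_filter_bank_completion[OF N _ degree_bound unit]
      unitary_filter_bank_completion[OF N _ _ unit] unitary_filter_matrix_iff[OF N]
    by (intro conjI allI impI) auto
qed

end
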